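(* Let $G$ be a locally compact second countable amenable group acting continuously on a compact metric space $X$, let $\mu$ be a $G$-invariant Borel probability measure on $X$, and fix a tempered Følner sequence $(F_n)$ in $G$. Suppose that $(X,G,\mu)$ is minimal, uniquely ergodic, mixing of all orders, has minimal self-joinings of all orders, and has no weakly asymptotic pairs; and that for every $N\ge1$ every point $(x_1,\dots,x_N)\in X^{\times N}$ is generic for some ergodic measure of $(X^{\times N},\{g^{\times N}\}_{g\in G})$. Then $(X,G)$ has topological minimal self-joinings of all orders.
   Context: Let $m$ be Haar measure on $G$, $Z(G)$ its center, $d_X$ the metric on $X$. Write $g^{\times N}(x_1,\dots,x_N)=(gx_1,\dots,gx_N)$. **Topological minimal self-joinings.** $(X,G)$ has $N$-fold topological minimal self-joinings ($N\ge2$) if for every $(x_1,\dots,x_N)\in X^{\times N}$ such that no two of the points $x_1,\dots,x_N$ lie in the same $G$-orbit, the orbit of $(x_1,\dots,x_N)$ under $\{g^{\times N}\}_{g\in G}$ is dense in $X^{\times N}$. It has them of all orders if this holds for every $N\ge2$. **Minimal / uniquely ergodic:** every orbit is dense / there is exactly one $G$-invariant Borel probability measure on $X$. **Mixing of all orders:** for every $N\ge1$ and Borel $A_0,\dots,A_N\subset X$, $\mu(g_0A_0\cap\dots\cap g_NA_N)\to\mu(A_0)\cdots\mu(A_N)$ as $g_i^{-1}g_j\to\infty$ for all $i\neq j$. **Joinings.** An $N$-fold self-joining is a $\{g^{\times N}\}_{g\in G}$-invariant Borel probability measure on $X^{\times N}$ with all one-coordinate marginals equal to $\mu$. Let ${}^N\Delta(A_1\times\dots\times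 A_N)=\mu(A_1\cap\dots\cap A_N)$, and for $\mathbf{g}=(g_1,\dots,g_N)\in G^N$ let ${}^N\Delta^{\mathbf g}=(g_1\times\dots\times g_N)_*{}^N\Delta$; it is called off-diagonal if $g_i^{-1}g_j\in Z(G)$ for all $i,j$. A self-joining is trivial if, possibly after permuting coordinates, it is a direct product of off-diagonal joinings (including the one-fold joining $\mu$). The system has minimal self-joinings of all orders if for every $N\ge2$ every $N$-fold self-joining that is ergodic for $(X^{\times N},\{g^{\times N}\}_{g\in G})$ is trivial. **Generic point.** $p\in X^{\times N}$ is generic for $\nu$ if $\frac1{m(F_n)}\int_{F_n}\delta_{g^{\times N}p}\,dm(g)\to\nu$ weakly$^*$. **Weakly asymptotic pair.** For $D\subset G$ let $\bar d(D)=\limsup_n m(F_n\cap D)/m(F_n)$. Points $x\ne y$ of $X$ form a weakly asymptotic pair if there is $D\subset G$ with $\bar d(D)>0$ such that $d_X(gx,gy)\to0$ as $g\to\infty$ along $D$. *)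

theory Defs
  imports "HOL-Probability.Probability"
begin

text \<open>
  The acting group is a type of class \<^class>\<open>topological_group_add\<close>. This class does not assume
  commutativity: the group operation is merely written additively, so that \<open>g h\<close>, \<open>g\<inverse> h\<close> and the
  neutral element read \<open>g + h\<close>, \<open>- g + h\<close> and \<open>0\<close>. The coordinates of the \<open>N\<close>-fold power of the
  space are indexed by \<open>{..<N}\<close>, and its points are the elements of
  \<open>{..<N} \<rightarrow>\<^sub>E UNIV\<close>.
\<close>

section \<open>The group\<close>

definition group_center :: "'g::group_add set" where
  "group_center = {z. \<forall>h. z + h = h + z}"

text \<open>The filter of complements of compact sets; ``\<open>g \<rightarrow> \<infinity>\<close>''.\<close>

definition cocompact :: "'a::topological_space filter" where
  "cocompact = (INF K\<in>{K. compact K}. principal (- K))"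

text \<open>Amenability: a left-invariant mean on the bounded continuous real functions.\<close>

definition amenable_group :: "'g::topological_group_add itself \<Rightarrow> bool" where
  "amenable_group _ \<longleftrightarrow>
     (\<exists>M :: ('g \<Rightarrow>\<^sub>C real) \<Rightarrow> real.
        linear M \<and> (\<forall>f. (\<forall>x. 0 \<le> apply_bcontfun f x) \<longrightarrow> 0 \<le> M f) \<and>
        M (const_bcontfun 1) = 1 \<and>
        (\<forall>g f. M (Bcontfun (\<lambda>x. apply_bcontfun f (g + x))) = M f))"

lemma left_translate_bcontfun:
  fixes f :: "'g::topological_group_add \<Rightarrow>\<^sub>C real"
  shows "(\<lambda>x. apply_bcontfun f (g + x)) \<in> bcontfun"
proof -
  have "continuous_on UNIV (\<lambda>x. apply_bcontfun f (g + x))"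
    by (rule continuous_on_compose2[of UNIV "apply_bcontfun f"]) (auto intro!: continuous_intros)
  moreover have "bounded (range (\<lambda>x. apply_bcontfun f (g + x)))"
    by (rule bounded_subset[OF bounded_apply_bcontfun[of f]]) auto
  ultimately show ?thesis by (simp add: bcontfun_def)
qed

text \<open>
  Left Haar measure. Regularity is not listed, since it is automatic for a locally finite Borel
  measure on a locally compact second countable Hausdorff space.
\<close>

definition haar_measure :: "'g::topological_group_add measure \<Rightarrow> bool" where
  "haar_measure m \<longleftrightarrow>
     sets m = sets borel \<and> emeasure m (space m) \<noteq> 0 \<and>
     (\<forall>K. compact K \<longrightarrow> emeasure m K < \<infinity>) \<and>
     (\<forall>g. distr m borel (\<lambda>h. g + h) = m)"

definition folner_sequence :: "'g::topological_group_add measure \<Rightarrow> (nat \<Rightarrow> 'g set) \<Rightarrow> bool" where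
  "folner_sequence m F \<longleftrightarrow>
     (\<forall>n. compact (F n) \<and> 0 < emeasure m (F n)) \<and>
     (\<forall>g. (\<lambda>n. measure m (sym_diff ((\<lambda>h. g + h) ` F n) (F n)) / measure m (F n)) \<longlonglongrightarrow> 0)"

text \<open>Shulman's condition \<open>m (\<Union>k<n. F\<^sub>k\<inverse> F\<^sub>n) \<le> C m (F\<^sub>n)\<close>.\<close>

definition tempered :: "'g::topological_group_add measure \<Rightarrow> (nat \<Rightarrow> 'g set) \<Rightarrow> bool" where
  "tempered m F \<longleftrightarrow>
     (\<exists>C::real. C > 0 \<and>
        (\<forall>n. emeasure m (\<Union>k<n. {- a + b | a b. a \<in> F k \<and> b \<in> F n})
               \<le> ennreal C * emeasure m (F n)))"

definition upper_density :: "'g measure \<Rightarrow> (nat \<Rightarrow> 'g set) \<Rightarrow> 'g set \<Rightarrow> ennreal" where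
  "upper_density m F D = limsup (\<lambda>n. emeasure m (F n \<inter> D) / emeasure m (F n))"


section \<open>Actions and their powers\<close>

definition continuous_action ::
    "('g::topological_group_add \<Rightarrow> 'x::topological_space \<Rightarrow> 'x) \<Rightarrow> bool" where
  "continuous_action act \<longleftrightarrow>
     (\<forall>x. act 0 x = x) \<and> (\<forall>g h x. act (g + h) x = act g (act h x)) \<and>
     continuous_on UNIV (\<lambda>(g, x). act g x)"

definition orbit :: "('g \<Rightarrow> 'y \<Rightarrow> 'y) \<Rightarrow> 'y \<Rightarrow> 'y set" where
  "orbit T y = range (\<lambda>g. T g y)"

definition power_act :: "('g \<Rightarrow> 'x \<Rightarrow> 'x) \<Rightarrow> nat \<Rightarrow> 'g \<Rightarrow> (nat \<Rightarrow> 'x) \<Rightarrow> (nat \<Rightarrow> 'x)" where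
  "power_act act N g p = (\<lambda>i\<in>{..<N}. act g (p i))"

definition power_topology :: "nat \<Rightarrow> (nat \<Rightarrow> 'x::topological_space) topology" where
  "power_topology N = product_topology (\<lambda>_. euclidean) {..<N}"

text \<open>
  For second countable \<open>'x\<close>, \<open>power_borel {..<N}\<close> is the Borel sigma-algebra of \<open>power_topology N\<close>.
  A general index set is allowed because joinings on blocks of coordinates are needed below.
\<close>

definition power_borel :: "nat set \<Rightarrow> (nat \<Rightarrow> 'x::topological_space) measure" where
  "power_borel I = PiM I (\<lambda>_. borel)"

text \<open>In the next two definitions \<open>S\<close> only supplies the measurable space on which \<open>\<nu>\<close> lives.\<close>

definition invariant_prob ::
    "('g \<Rightarrow> 'y \<Rightarrow> 'y) \<Rightarrow> 'y measure \<Rightarrow> 'y measure \<Rightarrow> bool" where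
  "invariant_prob T S \<nu> \<longleftrightarrow>
     sets \<nu> = sets S \<and> prob_space \<nu> \<and> (\<forall>g. distr \<nu> S (T g) = \<nu>)"

definition ergodic_prob ::
    "('g \<Rightarrow> 'y \<Rightarrow> 'y) \<Rightarrow> 'y measure \<Rightarrow> 'y measure \<Rightarrow> bool" where
  "ergodic_prob T S \<nu> \<longleftrightarrow>
     invariant_prob T S \<nu> \<and>
     (\<forall>A\<in>sets \<nu>. (\<forall>g. emeasure \<nu> (sym_diff (T g -` A \<inter> space \<nu>) A) = 0) \<longrightarrow>
        measure \<nu> A = 0 \<or> measure \<nu> A = 1)"


section \<open>Dynamical properties\<close>

definition minimal_action :: "('g \<Rightarrow> 'x::topological_space \<Rightarrow> 'x) \<Rightarrow> bool" where
  "minimal_action act \<longleftrightarrow> (\<forall>x. closure (orbit act x) = UNIV)"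

definition uniquely_ergodic :: "('g \<Rightarrow> 'x::topological_space \<Rightarrow> 'x) \<Rightarrow> bool" where
  "uniquely_ergodic act \<longleftrightarrow> (\<exists>!\<nu>. invariant_prob act borel \<nu>)"

definition mixing_all_orders ::
    "('g::topological_group_add \<Rightarrow> 'x::topological_space \<Rightarrow> 'x) \<Rightarrow> 'x measure \<Rightarrow> bool" where
  "mixing_all_orders act \<mu> \<longleftrightarrow>
     (\<forall>N\<ge>1. \<forall>A. (\<forall>i\<le>N. A i \<in> sets borel) \<longrightarrow>
        ((\<lambda>g. measure \<mu> (\<Inter>i\<le>N. act (g i) ` A i)) \<longlongrightarrow> (\<Prod>i\<le>N. measure \<mu> (A i)))
          (INF (i, j)\<in>{(i, j). i \<le> N \<and> j \<le> N \<and> i \<noteq> j}.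
             filtercomap (\<lambda>g :: nat \<Rightarrow> 'g. - g i + g j) cocompact))"

definition topological_msj :: "('g \<Rightarrow> 'x::topological_space \<Rightarrow> 'x) \<Rightarrow> nat \<Rightarrow> bool" where
  "topological_msj act N \<longleftrightarrow>
     (\<forall>p\<in>{..<N} \<rightarrow>\<^sub>E UNIV.
        (\<forall>i<N. \<forall>j<N. i \<noteq> j \<longrightarrow> p j \<notin> orbit act (p i)) \<longrightarrow>
        power_topology N closure_of orbit (power_act act N) p = topspace (power_topology N))"

definition topological_msj_all_orders :: "('g \<Rightarrow> 'x::topological_space \<Rightarrow> 'x) \<Rightarrow> bool" where
  "topological_msj_all_orders act \<longleftrightarrow> (\<forall>N\<ge>2. topological_msj act N)"

text \<open>
  \<open>D\<close> is required to be Borel so that its upper density makes sense (\<^const>\<open>emeasure\<close> vanishes on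
  non-measurable sets).
\<close>

definition weakly_asymptotic_pair ::
    "('g::topological_group_add \<Rightarrow> 'x::metric_space \<Rightarrow> 'x) \<Rightarrow> 'g measure \<Rightarrow> (nat \<Rightarrow> 'g set)
      \<Rightarrow> 'x \<Rightarrow> 'x \<Rightarrow> bool" where
  "weakly_asymptotic_pair act m F x y \<longleftrightarrow>
     x \<noteq> y \<and>
     (\<exists>D\<in>sets borel. upper_density m F D > 0 \<and>
        ((\<lambda>g. dist (act g x) (act g y)) \<longlongrightarrow> 0) (inf cocompact (principal D)))"


section \<open>Joinings\<close>

definition self_joining ::
    "('g \<Rightarrow> 'x::topological_space \<Rightarrow> 'x) \<Rightarrow> 'x measure \<Rightarrow> nat \<Rightarrow> (nat \<Rightarrow> 'x) measure \<Rightarrow> bool" where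
  "self_joining act \<mu> N \<nu> \<longleftrightarrow>
     invariant_prob (power_act act N) (power_borel {..<N}) \<nu> \<and>
     (\<forall>i<N. distr \<nu> borel (\<lambda>p. p i) = \<mu>)"

definition diagonal_joining ::
    "'x::topological_space measure \<Rightarrow> nat set \<Rightarrow> (nat \<Rightarrow> 'x) measure" where
  "diagonal_joining \<mu> I = distr \<mu> (power_borel I) (\<lambda>x. \<lambda>i\<in>I. x)"

lemma emeasure_diagonal_joining:
  assumes "sets \<mu> = sets borel" "finite I" "I \<noteq> {}" "\<And>i. i \<in> I \<Longrightarrow> A i \<in> sets borel"
  shows "emeasure (diagonal_joining \<mu> I) (Pi\<^sub>E I A) = emeasure \<mu> (\<Inter>i\<in>I. A i)"
proof -
  have "(\<lambda>x. \<lambda>i\<in>I. x) \<in> measurable \<mu> (power_borel I)"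
    unfolding power_borel_def by (intro measurable_restrict) (simp add: assms(1) measurable_ident_sets)
  moreover have "Pi\<^sub>E I A \<in> sets (power_borel I)"
    unfolding power_borel_def using assms by (intro sets_PiM_I_finite) auto
  moreover have "space \<mu> = UNIV" using sets_eq_imp_space_eq[OF assms(1)] by simp
  ultimately show ?thesis
    unfolding diagonal_joining_def
    by (subst emeasure_distr) (auto intro!: arg_cong[of _ _ "emeasure \<mu>"] simp: PiE_iff)
qed

definition translated_diagonal ::
    "('g \<Rightarrow> 'x::topological_space \<Rightarrow> 'x) \<Rightarrow> 'x measure \<Rightarrow> nat set \<Rightarrow> (nat \<Rightarrow> 'g)
      \<Rightarrow> (nat \<Rightarrow> 'x) measure" where
  "translated_diagonal act \<mu> I g =
     distr (diagonal_joining \<mu> I) (power_borel I) (\<lambda>p. \<lambda>i\<in>I. act (g i) (p i))"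

definition off_diagonal :: "nat set \<Rightarrow> (nat \<Rightarrow> 'g::group_add) \<Rightarrow> bool" where
  "off_diagonal I g \<longleftrightarrow> (\<forall>i\<in>I. \<forall>j\<in>I. - g i + g j \<in> group_center)"

text \<open>
  A product of off-diagonal joinings up to a permutation of the coordinates is given by a partition
  of \<open>{..<N}\<close> into blocks. The partition is encoded by a labelling \<open>c\<close>, the block of label \<open>k\<close>
  being \<open>{i. i < N \<and> c i = k}\<close>; the outer push-forward merges the family of blocks into a single
  \<open>N\<close>-tuple. On a one-element block \<open>translated_diagonal\<close> is (a copy of) \<open>\<mu>\<close>.
\<close>

definition trivial_joining ::
    "('g::group_add \<Rightarrow> 'x::topological_space \<Rightarrow> 'x) \<Rightarrow> 'x measure \<Rightarrow> nat
      \<Rightarrow> (nat \<Rightarrow> 'x) measure \<Rightarrow> bool" where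
  "trivial_joining act \<mu> N \<nu> \<longleftrightarrow>
     (\<exists>(c :: nat \<Rightarrow> nat) g.
        (\<forall>k\<in>c ` {..<N}. off_diagonal {i. i < N \<and> c i = k} g) \<and>
        \<nu> = distr
              (PiM (c ` {..<N}) (\<lambda>k. translated_diagonal act \<mu> {i. i < N \<and> c i = k} g))
              (power_borel {..<N})
              (\<lambda>\<omega>. \<lambda>i\<in>{..<N}. \<omega> (c i) i))"

definition msj_all_orders ::
    "('g::group_add \<Rightarrow> 'x::topological_space \<Rightarrow> 'x) \<Rightarrow> 'x measure \<Rightarrow> bool" where
  "msj_all_orders act \<mu> \<longleftrightarrow>
     (\<forall>N\<ge>2. \<forall>\<nu>. self_joining act \<mu> N \<nu> \<and>
         ergodic_prob (power_act act N) (power_borel {..<N}) \<nu> \<longrightarrow> trivial_joining act \<mu> N \<nu>)"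


section \<open>Generic points\<close>

text \<open>The measure \<open>1/m(F\<^sub>n) \<integral>\<^bsub>F\<^sub>n\<^esub> \<delta>\<^bsub>g p\<^esub> dm(g)\<close>.\<close>

definition empirical_measure ::
    "('g \<Rightarrow> 'x::topological_space \<Rightarrow> 'x) \<Rightarrow> 'g measure \<Rightarrow> 'g set \<Rightarrow> nat \<Rightarrow> (nat \<Rightarrow> 'x)
      \<Rightarrow> (nat \<Rightarrow> 'x) measure" where
  "empirical_measure act m E N p =
     distr (uniform_measure m E) (power_borel {..<N}) (\<lambda>g. power_act act N g p)"

definition weak_star_conv ::
    "nat \<Rightarrow> (nat \<Rightarrow> (nat \<Rightarrow> 'x::topological_space) measure) \<Rightarrow> (nat \<Rightarrow> 'x) measure \<Rightarrow> bool" where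
  "weak_star_conv N \<nu>s \<nu> \<longleftrightarrow>
     (\<forall>f. continuous_map (power_topology N) euclideanreal f \<longrightarrow>
        (\<lambda>n. integral\<^sup>L (\<nu>s n) f) \<longlonglongrightarrow> integral\<^sup>L \<nu> f)"

definition generic_point ::
    "('g \<Rightarrow> 'x::topological_space \<Rightarrow> 'x) \<Rightarrow> 'g measure \<Rightarrow> (nat \<Rightarrow> 'g set) \<Rightarrow> nat
      \<Rightarrow> (nat \<Rightarrow> 'x) \<Rightarrow> (nat \<Rightarrow> 'x) measure \<Rightarrow> bool" where
  "generic_point act m F N p \<nu> \<longleftrightarrow>
     weak_star_conv N (\<lambda>n. empirical_measure act m (F n) N p) \<nu>"

end

theory Submission
  imports Defs
begin

text \<open>
  Let \<open>p\<close> be a point of the \<open>N\<close>-fold power with coordinates in distinct orbits, generic for the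
  ergodic measure \<open>\<nu>\<close>. By unique ergodicity each coordinate marginal of \<open>\<nu>\<close> is \<open>\<mu>\<close>
  (\<open>invariant_measure_is_self_joining\<close>), so \<open>\<nu>\<close> is an ergodic self-joining and therefore trivial:
  up to the order of the coordinates, a product of off-diagonal joinings. There are two cases
  (\<open>trivial_joining_cases\<close>).

  Suppose two coordinates \<open>i \<noteq> j\<close> lie in the same block. Then \<open>\<nu>\<close> is carried by the graph
  \<open>q\<^sub>j = z q\<^sub>i\<close> of a central element \<open>z\<close>. The averages of the distance between \<open>z g p\<^sub>i = g (z p\<^sub>i)\<close>
  and \<open>g p\<^sub>j\<close> over the Folner sets tend to its integral against \<open>\<nu>\<close>, which is \<open>0\<close>. Vanishing
  averages of a bounded nonnegative function give convergence to \<open>0\<close> along a set of positive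
  upper density (\<open>upper_density_pos_if_averages_vanish\<close>). Since \<open>z p\<^sub>i \<noteq> p\<^sub>j\<close>, as the orbits are
  distinct, \<open>z p\<^sub>i\<close> and \<open>p\<^sub>j\<close> form a weakly asymptotic pair, which is excluded.

  So all blocks are singletons and \<open>\<nu>\<close> is the product measure. By minimality \<open>\<mu>\<close> charges every
  nonempty open set (\<open>minimal_full_support\<close>), so \<open>\<nu>\<close> charges every nonempty open box. A bump
  function supported in such a box has positive integral, hence positive averages along the orbit
  of its generic point \<open>p\<close>, and the orbit meets the box (\<open>product_joining_dense_orbit\<close>).
\<close>

section \<open>Measurability of the distance on a compact metric space\<close>

lemma compact_countable_dense:
  assumes "compact (UNIV :: 'a::metric_space set)"
  shows "\<exists>S :: 'a set. countable S \<and> (\<forall>x. \<forall>e>0. \<exists>s\<in>S. dist x s < e)"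
proof -
  have "\<exists>k :: 'a set. finite k \<and> UNIV \<subseteq> (\<Union>s\<in>k. ball s (1 / real (Suc n)))" for n
    using compact_imp_seq_compact[OF assms, THEN seq_compact_imp_totally_bounded] by auto
  then obtain k :: "nat \<Rightarrow> 'a set"
    where k: "\<And>n. finite (k n)" "\<And>n. UNIV \<subseteq> (\<Union>s\<in>k n. ball s (1 / real (Suc n)))" by metis
  have "\<exists>s\<in>\<Union>(range k). dist x s < e" if e: "e > 0" for x e
  proof -
    obtain n where n: "1 / real (Suc n) < e"
      using reals_Archimedean[OF e] by (auto simp: inverse_eq_divide)
    have "x \<in> (\<Union>s\<in>k n. ball s (1 / real (Suc n)))" using k(2)[of n] by blast
    then obtain s where "s \<in> k n" "dist s x < 1 / real (Suc n)" by auto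
    then show ?thesis using n by (intro bexI[of _ s]) (auto simp: dist_commute)
  qed
  moreover have "countable (\<Union>(range k))"
    using k(1) by (intro countable_UN) (auto intro: countable_finite)
  ultimately show ?thesis by blast
qed

text \<open>
  Joint continuity of the distance is not enough in a general metric space, where the Borel sets of
  the square need not be generated by rectangles; separability is the point. For a countable dense
  set \<open>S\<close>, \<open>dist a b\<close> is the infimum of \<open>dist a s + dist b s\<close> over \<open>s \<in> S\<close>, and each of these terms
  is a sum of continuous functions of one variable.
\<close>

lemma borel_measurable_dist_compact:
  fixes f g :: "'b \<Rightarrow> 'a::metric_space"
  assumes "compact (UNIV :: 'a set)"
    and f[measurable]: "f \<in> measurable M borel" and g[measurable]: "g \<in> measurable M borel"
  shows "(\<lambda>x. dist (f x) (g x)) \<in> borel_measurable M"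
proof -
  obtain S :: "'a set" where S: "countable S" "\<And>x e. e > 0 \<Longrightarrow> \<exists>s\<in>S. dist x s < e"
    using compact_countable_dense[OF assms(1)] by blast
  have inf: "dist a b = (INF s\<in>S. dist a s + dist b s)" for a b :: 'a
  proof (rule antisym)
    show "dist a b \<le> (INF s\<in>S. dist a s + dist b s)"
      using S(2)[of 1] by (intro cINF_greatest) (auto simp: dist_triangle2)
    show "(INF s\<in>S. dist a s + dist b s) \<le> dist a b"
    proof (rule field_le_epsilon)
      fix e :: real assume "e > 0"
      then obtain s where s: "s \<in> S" "dist b s < e / 2" using S(2)[of "e/2" b] by auto
      have "bdd_below ((\<lambda>s. dist a s + dist b s) ` S)" by (rule bdd_belowI[of _ 0]) auto
      then have "(INF s\<in>S. dist a s + dist b s) \<le> dist a s + dist b s"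
        using s by (intro cINF_lower) auto
      also have "\<dots> \<le> dist a b + e" using dist_triangle[of a s b] s by linarith
      finally show "(INF s\<in>S. dist a s + dist b s) \<le> dist a b + e" .
    qed
  qed
  have m: "(\<lambda>y. dist y s) \<in> borel_measurable (borel :: 'a measure)" for s
    by (intro borel_measurable_continuous_onI continuous_intros)
  have "(\<lambda>x. INF s\<in>S. dist (f x) s + dist (g x) s) \<in> borel_measurable M"
    by (intro borel_measurable_cINF_real borel_measurable_add S(1)
          measurable_compose[OF f m] measurable_compose[OF g m])
  then show ?thesis by (simp only: inf[symmetric])
qed

lemma compact_dist_bounded:
  assumes "compact (UNIV :: 'a::metric_space set)"
  obtains B where "\<And>x y :: 'a. dist x y \<le> B"
  using compact_imp_bounded[OF assms] unfolding bounded_two_points by auto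

section \<open>Invariant measures and joinings\<close>

lemma continuous_action_continuous:
  assumes "continuous_action act"
  shows "continuous_on UNIV (act g)" "continuous_on UNIV (\<lambda>g. act g x)"
proof -
  have c: "continuous_on UNIV (\<lambda>(g, x). act g x)" using assms by (simp add: continuous_action_def)
  have p: "continuous_on UNIV (\<lambda>x. (g, x))" "continuous_on UNIV (\<lambda>g. (g, x))"
    by (intro continuous_on_Pair continuous_on_const continuous_on_id)+
  show "continuous_on UNIV (act g)" "continuous_on UNIV (\<lambda>g. act g x)"
    using continuous_on_compose2[OF c p(1)] continuous_on_compose2[OF c p(2)] by simp_all
qed

lemma continuous_action_measurable:
  assumes "continuous_action act"
  shows "act g \<in> measurable borel borel"
  using continuous_action_continuous[OF assms] by (intro borel_measurable_continuous_onI)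

lemma prod_ennreal_pos:
  fixes f :: "'a \<Rightarrow> ennreal"
  assumes "finite A" "\<And>i. i \<in> A \<Longrightarrow> f i > 0"
  shows "(\<Prod>i\<in>A. f i) > 0"
  using assms by (induction A) (auto simp: ennreal_zero_less_mult_iff)

text \<open>
  By minimality the translates of \<open>U\<close> cover the space, and by compactness finitely many of them
  suffice. They all have the measure of \<open>U\<close>, so this measure cannot vanish.
\<close>

lemma minimal_full_support:
  fixes act :: "'g::topological_group_add \<Rightarrow> 'x::metric_space \<Rightarrow> 'x"
  assumes "compact (UNIV :: 'x set)" "continuous_action act" "minimal_action act"
    "invariant_prob act borel \<mu>" "open U" "U \<noteq> {}"
  shows "emeasure \<mu> U > 0"
proof (rule ccontr)
  assume "\<not> emeasure \<mu> U > 0"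
  then have U0: "emeasure \<mu> U = 0" by simp
  have sets: "sets \<mu> = sets borel" and prob: "prob_space \<mu>" and inv: "distr \<mu> borel (act g) = \<mu>" for g
    using assms(4) by (auto simp: invariant_prob_def)
  have space: "space \<mu> = UNIV" using sets_eq_imp_space_eq[OF sets] by simp
  have op: "open (act g -` U)" for g
    using continuous_action_continuous(1)[OF assms(2)] assms(5) by (simp add: continuous_on_open_vimage)
  have null: "emeasure \<mu> (act g -` U) = 0" for g
  proof -
    have "emeasure \<mu> (act g -` U) = emeasure (distr \<mu> borel (act g)) U"
      using continuous_action_measurable[OF assms(2), of g] assms(5)
      by (subst emeasure_distr) (auto simp: space measurable_cong_sets[OF sets refl])
    then show ?thesis using U0 inv by simp
  qed
  have "\<exists>g. x \<in> act g -` U" for x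
  proof -
    have "closure (orbit act x) = UNIV" using assms(3) by (simp add: minimal_action_def)
    then have "U \<inter> orbit act x \<noteq> {}"
      using assms(5,6) open_Int_closure_eq_empty[of U "orbit act x"] by auto
    then show ?thesis by (auto simp: orbit_def)
  qed
  then have cover: "UNIV \<subseteq> (\<Union>g\<in>UNIV. act g -` U)" by auto
  obtain C where C: "finite C" "UNIV \<subseteq> (\<Union>g\<in>C. act g -` U)"
    by (rule compactE_image[OF assms(1) op cover]) auto
  have "emeasure \<mu> (\<Union>g\<in>C. act g -` U) \<le> (\<Sum>g\<in>C. emeasure \<mu> (act g -` U))"
    using C(1) op by (intro emeasure_subadditive_finite) (auto simp: sets)
  then have "emeasure \<mu> (space \<mu>) = 0" using C(2) null by (simp add: space top.extremum_unique)
  then show False using prob_space.emeasure_space_1[OF prob] by simp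
qed

text \<open>
  The coordinate projections commute with the action, so the marginals of an invariant measure are
  invariant; unique ergodicity leaves only \<open>\<mu>\<close>.
\<close>

lemma invariant_measure_is_self_joining:
  assumes "continuous_action act" "uniquely_ergodic act" "invariant_prob act borel \<mu>"
    and \<nu>: "invariant_prob (power_act act N) (power_borel {..<N}) \<nu>"
  shows "self_joining act \<mu> N \<nu>"
  unfolding self_joining_def
proof (intro conjI allI impI \<nu>)
  fix i assume i: "i < N"
  have sets: "sets \<nu> = sets (power_borel {..<N})" and prob: "prob_space \<nu>"
    and inv: "distr \<nu> (power_borel {..<N}) (power_act act N g) = \<nu>" for g
    using \<nu> by (auto simp: invariant_prob_def)
  have pr[measurable]: "(\<lambda>p. p i) \<in> measurable (power_borel {..<N}) borel"
    using i unfolding power_borel_def by (intro measurable_component_singleton) simp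
  have pr\<nu>: "(\<lambda>p. p i) \<in> measurable \<nu> borel" using pr by (simp cong: measurable_cong_sets add: sets)
  have act: "act g \<in> measurable borel borel" for g by (rule continuous_action_measurable[OF assms(1)])
  have pa: "power_act act N g \<in> measurable \<nu> (power_borel {..<N})" for g
    unfolding power_act_def measurable_cong_sets[OF sets refl] unfolding power_borel_def
    by (intro measurable_restrict measurable_compose[OF _ act]) (auto intro: measurable_component_singleton)
  have "distr (distr \<nu> borel (\<lambda>p. p i)) borel (act g) = distr \<nu> borel (\<lambda>p. p i)" for g
  proof -
    have "distr (distr \<nu> borel (\<lambda>p. p i)) borel (act g) = distr \<nu> borel (act g \<circ> (\<lambda>p. p i))"
      by (rule distr_distr[OF act pr\<nu>])
    also have "act g \<circ> (\<lambda>p. p i) = (\<lambda>p. p i) \<circ> power_act act N g"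
      using i by (auto simp: power_act_def)
    also have "distr \<nu> borel \<dots> = distr (distr \<nu> (power_borel {..<N}) (power_act act N g)) borel (\<lambda>p. p i)"
      by (rule distr_distr[OF pr pa, symmetric])
    finally show ?thesis by (simp add: inv)
  qed
  then have "invariant_prob act borel (distr \<nu> borel (\<lambda>p. p i))"
    unfolding invariant_prob_def using prob_space.prob_space_distr[OF prob pr\<nu>] by simp
  then show "distr \<nu> borel (\<lambda>p. p i) = \<mu>"
    using assms(2,3) unfolding uniquely_ergodic_def by blast
qed

lemma translated_diagonal_eq_distr:
  assumes "continuous_action act" and sets: "sets \<mu> = sets borel"
  shows "translated_diagonal act \<mu> I g = distr \<mu> (power_borel I) (\<lambda>x. \<lambda>i\<in>I. act (g i) x)"
    and "(\<lambda>x. \<lambda>i\<in>I. act (g i) x) \<in> measurable \<mu> (power_borel I)"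
proof -
  have act: "act g \<in> measurable borel borel" for g by (rule continuous_action_measurable[OF assms(1)])
  have 1: "(\<lambda>x. \<lambda>i\<in>I. x) \<in> measurable \<mu> (power_borel I)"
    unfolding power_borel_def by (intro measurable_restrict) (simp add: sets measurable_ident_sets)
  have 2: "(\<lambda>p. \<lambda>i\<in>I. act (g i) (p i)) \<in> measurable (power_borel I) (power_borel I)"
    unfolding power_borel_def
    by (intro measurable_restrict measurable_compose[OF _ act]) (auto intro: measurable_component_singleton)
  show "translated_diagonal act \<mu> I g = distr \<mu> (power_borel I) (\<lambda>x. \<lambda>i\<in>I. act (g i) x)"
    unfolding translated_diagonal_def diagonal_joining_def distr_distr[OF 2 1]
    by (intro arg_cong[of _ _ "distr \<mu> (power_borel I)"]) (auto simp: fun_eq_iff)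
  show "(\<lambda>x. \<lambda>i\<in>I. act (g i) x) \<in> measurable \<mu> (power_borel I)"
    unfolding power_borel_def
    by (intro measurable_restrict) (simp add: measurable_cong_sets[OF sets refl] act)
qed

lemma prob_space_translated_diagonal:
  assumes "continuous_action act" and "sets \<mu> = sets borel" "prob_space \<mu>"
  shows "prob_space (translated_diagonal act \<mu> I g)"
  unfolding translated_diagonal_eq_distr(1)[OF assms(1,2)]
  by (rule prob_space.prob_space_distr[OF assms(3) translated_diagonal_eq_distr(2)[OF assms(1,2)]])

lemma merge_blocks_measurable:
  "(\<lambda>\<omega>. \<lambda>i\<in>{..<N}. \<omega> (c i) i) \<in>
     measurable (PiM (c ` {..<N}) (\<lambda>k. translated_diagonal act \<mu> {i. i < N \<and> c i = k} g))
       (power_borel {..<N})"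
  unfolding power_borel_def
proof (rule measurable_restrict)
  fix i assume i: "i \<in> {..<N}"
  have "(\<lambda>\<omega>. \<omega> (c i)) \<in> measurable (PiM (c ` {..<N}) (\<lambda>k. translated_diagonal act \<mu> {i. i < N \<and> c i = k} g))
     (translated_diagonal act \<mu> {j. j < N \<and> c j = c i} g)"
    using i by (intro measurable_component_singleton) auto
  moreover have "(\<lambda>p. p i) \<in> measurable (translated_diagonal act \<mu> {j. j < N \<and> c j = c i} g) borel"
    using i unfolding translated_diagonal_def power_borel_def
    by (auto intro: measurable_component_singleton)
  ultimately show "(\<lambda>\<omega>. \<omega> (c i) i) \<in>
     measurable (PiM (c ` {..<N}) (\<lambda>k. translated_diagonal act \<mu> {i. i < N \<and> c i = k} g)) borel"
    by (rule measurable_compose)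
qed

text \<open>
  Let \<open>c\<close> label the blocks. If \<open>c i = c j\<close> with \<open>i \<noteq> j\<close>, then on that block the joining is the
  distribution of \<open>x \<mapsto> (g\<^sub>i x, g\<^sub>j x)\<close>, which lies on the graph of \<open>z = g\<^sub>j g\<^sub>i\<inverse>\<close>; since
  \<open>g\<^sub>i\<inverse> g\<^sub>j\<close> is central, it is unchanged by conjugation with \<open>g\<^sub>i\<close> and so
  equals \<open>z\<close>. If \<open>c\<close> is injective, every block contributes a copy of \<open>\<mu>\<close>, and boxes have product
  measure.
\<close>

lemma trivial_joining_cases:
  fixes act :: "'g::topological_group_add \<Rightarrow> 'x::metric_space \<Rightarrow> 'x"
  assumes X: "compact (UNIV :: 'x set)" and act: "continuous_action act"
    and sets: "sets \<mu> = sets borel" and prob: "prob_space \<mu>"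
    and inv: "\<And>g. distr \<mu> borel (act g) = \<mu>"
    and triv: "trivial_joining act \<mu> N \<nu>"
  obtains i j z where "i < N" "j < N" "i \<noteq> j" "z \<in> group_center"
      "AE p in \<nu>. dist (act z (p i)) (p j) = 0"
  | "\<And>A. (\<And>i. i < N \<Longrightarrow> A i \<in> sets borel) \<Longrightarrow>
       emeasure \<nu> (Pi\<^sub>E {..<N} A) = (\<Prod>i<N. emeasure \<mu> (A i))"
proof -
  obtain c :: "nat \<Rightarrow> nat" and g where
    off: "\<And>k. k \<in> c ` {..<N} \<Longrightarrow> off_diagonal {i. i < N \<and> c i = k} g" and
    \<nu>: "\<nu> = distr (PiM (c ` {..<N}) (\<lambda>k. translated_diagonal act \<mu> {i. i < N \<and> c i = k} g))
              (power_borel {..<N}) (\<lambda>\<omega>. \<lambda>i\<in>{..<N}. \<omega> (c i) i)"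
    using triv unfolding trivial_joining_def by blast
  define J where "J = c ` {..<N}"
  define I where "I = (\<lambda>k. {i. i < N \<and> c i = k})"
  define M where "M = (\<lambda>k. translated_diagonal act \<mu> (I k) g)"
  have \<nu>': "\<nu> = distr (PiM J M) (power_borel {..<N}) (\<lambda>\<omega>. \<lambda>i\<in>{..<N}. \<omega> (c i) i)"
    unfolding J_def M_def I_def by (rule \<nu>)
  have merge: "(\<lambda>\<omega>. \<lambda>i\<in>{..<N}. \<omega> (c i) i) \<in> measurable (PiM J M) (power_borel {..<N})"
    unfolding J_def M_def I_def by (rule merge_blocks_measurable)
  have Mdistr: "M k = distr \<mu> (power_borel (I k)) (\<lambda>x. \<lambda>i\<in>I k. act (g i) x)" for k
    unfolding M_def by (rule translated_diagonal_eq_distr(1)[OF act sets])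
  have Mmeas: "(\<lambda>x. \<lambda>i\<in>I k. act (g i) x) \<in> measurable \<mu> (power_borel (I k))" for k
    by (rule translated_diagonal_eq_distr(2)[OF act sets])
  have Mprob: "prob_space (M k)" for k
    unfolding M_def by (rule prob_space_translated_diagonal[OF act sets prob])
  have actm: "act g \<in> measurable borel borel" for g by (rule continuous_action_measurable[OF act])
  have space: "space \<mu> = UNIV" using sets_eq_imp_space_eq[OF sets] by simp
  have graph: "{p \<in> space (power_borel K). dist (act z (p i)) (p j) = 0} \<in> sets (power_borel K)"
    if "i \<in> K" "j \<in> K" for i j z and K
  proof -
    have "(\<lambda>p. dist (act z (p i)) (p j)) \<in> borel_measurable (power_borel K)"
      using that unfolding power_borel_def
      by (intro borel_measurable_dist_compact[OF X] measurable_compose[OF _ actm]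
            measurable_component_singleton)
    then show ?thesis by measurable
  qed
  show thesis
  proof (cases "inj_on c {..<N}")
    case False
    then obtain i j where ij: "i < N" "j < N" "i \<noteq> j" "c i = c j" by (auto simp: inj_on_def)
    define z where "z = g j - g i"
    have "- g i + g j \<in> group_center"
      using off[of "c i"] ij by (auto simp: off_diagonal_def)
    then have cen: "- g i + g j + h = h + (- g i + g j)" for h by (auto simp: group_center_def)
    have zg: "z + g i = g j" by (simp add: z_def)
    have "z = - g i + g j"
    proof -
      have "g j = g i + (- g i + g j)" by (simp add: add.assoc[symmetric])
      also have "\<dots> = (- g i + g j) + g i" by (rule cen[symmetric])
      finally show ?thesis unfolding z_def by (metis add_diff_cancel)
    qed
    then have z: "z \<in> group_center" using cen by (auto simp: group_center_def)
    have i: "i \<in> I (c i)" and j: "j \<in> I (c i)" using ij by (auto simp: I_def)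
    have "AE p in M (c i). dist (act z (p i)) (p j) = 0"
      unfolding Mdistr using i j act
      by (subst AE_distr_iff[OF Mmeas graph]) (auto simp: continuous_action_def zg[symmetric])
    then have "AE \<omega> in PiM J M. dist (act z (\<omega> (c i) i)) (\<omega> (c i) j) = 0"
      using ij by (intro AE_PiM_component Mprob) (auto simp: J_def)
    then have "AE p in \<nu>. dist (act z (p i)) (p j) = 0"
      unfolding \<nu>' using ij by (subst AE_distr_iff[OF merge graph]) auto
    with that(1) ij z show ?thesis by blast
  next
    case True
    have I: "I (c i) = {i}" if "i < N" for i
      using True that by (auto simp: I_def inj_on_def)
    have "emeasure \<nu> (Pi\<^sub>E {..<N} A) = (\<Prod>i<N. emeasure \<mu> (A i))"
      if A: "\<And>i. i < N \<Longrightarrow> A i \<in> sets borel" for A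
    proof -
      define d where "d = the_inv_into {..<N} c"
      have d: "d (c i) = i" if "i < N" for i
        using True that by (simp add: d_def the_inv_into_f_f)
      interpret product_sigma_finite M
        by (intro product_sigma_finite.intro prob_space_imp_sigma_finite Mprob)
      \<comment> \<open>The condition that the box imposes on the factor with label \<open>k\<close>, whose block is \<open>{d k}\<close>.\<close>
      define E where "E = (\<lambda>k. {p \<in> space (M k). p (d k) \<in> A (d k)})"
      have pr: "(\<lambda>p. p i) \<in> measurable (M (c i)) borel" if "i < N" for i
        using I[OF that] unfolding Mdistr power_borel_def
        by (auto intro: measurable_component_singleton)
      have Esets: "E (c i) \<in> sets (M (c i))" if "i < N" for i
        unfolding E_def using measurable_sets[OF pr[OF that] A[OF that]] d[OF that]
        by (auto simp: vimage_def Int_def conj_commute)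
      have box: "Pi\<^sub>E {..<N} A \<in> sets (power_borel {..<N})"
        unfolding power_borel_def using A by (intro sets_PiM_I_finite) auto
      have "(\<lambda>\<omega>. \<lambda>i\<in>{..<N}. \<omega> (c i) i) -` Pi\<^sub>E {..<N} A \<inter> space (PiM J M) = Pi\<^sub>E J E"
        by (auto simp: J_def space_PiM PiE_iff E_def d)
      then have "emeasure \<nu> (Pi\<^sub>E {..<N} A) = emeasure (PiM J M) (Pi\<^sub>E J E)"
        unfolding \<nu>' by (simp add: emeasure_distr[OF merge box])
      also have "\<dots> = (\<Prod>k\<in>J. emeasure (M k) (E k))"
        using Esets by (intro emeasure_PiM) (auto simp: J_def)
      also have "\<dots> = (\<Prod>i<N. emeasure (M (c i)) (E (c i)))"
        unfolding J_def by (subst prod.reindex[OF True]) simp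
      also have "\<dots> = (\<Prod>i<N. emeasure \<mu> (A i))"
      proof (intro prod.cong refl)
        fix i assume "i \<in> {..<N}"
        then have i: "i < N" by simp
        have "emeasure (M (c i)) (E (c i)) = emeasure \<mu> (act (g i) -` A i)"
          using Esets[OF i] I[OF i] d[OF i] unfolding Mdistr
          by (subst emeasure_distr[OF Mmeas])
             (auto simp: E_def Mdistr space power_borel_def space_PiM intro!: arg_cong[of _ _ "emeasure \<mu>"])
        also have "\<dots> = emeasure (distr \<mu> borel (act (g i))) (A i)"
          using A[OF i] actm by (subst emeasure_distr) (auto simp: space measurable_cong_sets[OF sets refl])
        finally show "emeasure (M (c i)) (E (c i)) = emeasure \<mu> (A i)" by (simp add: inv)
      qed
      finally show ?thesis .
    qed
    with that(2) show ?thesis by blast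
  qed
qed

section \<open>Averages along the orbit of a point\<close>

lemma uniform_measure_folner_set:
  fixes F :: "nat \<Rightarrow> 'g::{topological_group_add, t2_space} set"
  assumes "haar_measure m" "folner_sequence m F"
  shows "prob_space (uniform_measure m (F n))"
    and "F n \<in> sets m"
    and "emeasure m (F n) < \<infinity>"
proof -
  have c: "compact (F n)" and pos: "0 < emeasure m (F n)"
    using assms(2) unfolding folner_sequence_def by blast+
  show fin: "emeasure m (F n) < \<infinity>"
    using assms(1) c unfolding haar_measure_def by blast
  show "prob_space (uniform_measure m (F n))"
    using pos fin by (intro prob_space_uniform_measure) auto
  show "F n \<in> sets m" using assms(1) c
    by (simp add: haar_measure_def borel_closed compact_imp_closed)
qed

lemma generic_point_averages:
  fixes act :: "'g::{topological_group_add} \<Rightarrow> 'x::topological_space \<Rightarrow> 'x"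
  assumes "continuous_action act" "haar_measure m"
    and "generic_point act m F N p \<nu>"
    and "continuous_map (power_topology N) euclideanreal f"
    and f: "f \<in> borel_measurable (power_borel {..<N})"
  shows "(\<lambda>n. \<integral>g. f (power_act act N g p) \<partial>uniform_measure m (F n)) \<longlonglongrightarrow> integral\<^sup>L \<nu> f"
proof -
  have sets: "sets m = sets borel" using assms(2) by (simp add: haar_measure_def)
  have "(\<lambda>g. power_act act N g p) \<in> measurable (uniform_measure m (F n)) (power_borel {..<N})" for n
    unfolding power_act_def power_borel_def
    by (intro measurable_restrict)
       (auto simp: sets cong: measurable_cong_sets
         intro!: borel_measurable_continuous_onI continuous_action_continuous(2)[OF assms(1)])
  then have "integral\<^sup>L (empirical_measure act m (F n) N p) f =
      (\<integral>g. f (power_act act N g p) \<partial>uniform_measure m (F n))" for n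
    unfolding empirical_measure_def by (rule integral_distr[OF _ f])
  then show ?thesis
    using assms(3,4) unfolding generic_point_def weak_star_conv_def by (metis (no_types, lifting) ext)
qed

text \<open>
  By Markov's inequality each sublevel set \<open>V k = {\<phi> < 1/(k+1)}\<close> fills at least half of some
  Folner set \<open>F (n k)\<close> with \<open>n k \<ge> k\<close>. The union \<open>D\<close> of the pieces \<open>F (n k) \<inter> V k\<close> has upper density
  at least \<open>1/2\<close>. A point of \<open>D\<close> outside the compact set \<open>F (n 0) \<union> \<dots> \<union> F (n (k-1))\<close> belongs to a
  piece with index at least \<open>k\<close>, so \<open>\<phi> < 1/(k+1)\<close> there.
\<close>

lemma upper_density_pos_if_averages_vanish:
  fixes F :: "nat \<Rightarrow> 'g::{topological_group_add, t2_space} set" and \<phi> :: "'g \<Rightarrow> real"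
  assumes m: "haar_measure m" and F: "folner_sequence m F"
    and cont: "continuous_on UNIV \<phi>" and nn: "\<And>g. 0 \<le> \<phi> g" and bd: "\<And>g. \<phi> g \<le> B"
    and lim: "(\<lambda>n. \<integral>g. \<phi> g \<partial>uniform_measure m (F n)) \<longlonglongrightarrow> 0"
  shows "\<exists>D\<in>sets borel. upper_density m F D > 0 \<and> (\<phi> \<longlongrightarrow> 0) (inf cocompact (principal D))"
proof -
  have sets: "sets m = sets borel" using m by (simp add: haar_measure_def)
  have space: "space m = UNIV" using sets_eq_imp_space_eq[OF sets] by simp
  define V where "V = (\<lambda>k. {g. \<phi> g < 1 / real (Suc k)})"
  have Vop: "open (V k)" for k
    unfolding V_def using cont by (intro open_Collect_less) (auto intro: continuous_intros)
  have half: "\<exists>n\<ge>k. emeasure m (F n \<inter> V k) / emeasure m (F n) \<ge> ennreal (1/2)" for k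
  proof -
    have "\<forall>\<^sub>F n in sequentially. (\<integral>g. \<phi> g \<partial>uniform_measure m (F n)) < 1 / real (Suc k) / 2"
      by (rule order_tendstoD(2)[OF lim]) simp
    then obtain n where n: "n \<ge> k" "(\<integral>g. \<phi> g \<partial>uniform_measure m (F n)) < 1 / real (Suc k) / 2"
      unfolding eventually_sequentially by (meson nle_le)
    interpret P: prob_space "uniform_measure m (F n)" by (rule uniform_measure_folner_set[OF m F])
    have \<phi>m: "\<phi> \<in> borel_measurable (uniform_measure m (F n))"
      using cont by (simp add: sets borel_measurable_continuous_onI cong: measurable_cong_sets)
    have int: "integrable (uniform_measure m (F n)) \<phi>"
      using nn bd by (intro P.integrable_const_bound[of _ B] \<phi>m) auto
    have "P.prob {g \<in> space (uniform_measure m (F n)). \<phi> g \<ge> 1 / real (Suc k)}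
        \<le> (\<integral>g. \<phi> g \<partial>uniform_measure m (F n)) / (1 / real (Suc k))"
      using nn by (intro integral_Markov_inequality_measure[OF int, of UNIV]) (auto simp: sets)
    also have "\<dots> \<le> 1/2" using n(2) by (simp add: field_simps)
    finally have "P.prob (space (uniform_measure m (F n)) - V k) \<le> 1/2"
      by (simp add: V_def space Diff_eq Collect_neg_eq[symmetric] not_less)
    moreover have "V k \<in> P.events" using Vop by (simp add: sets)
    ultimately have "P.prob (V k) \<ge> 1/2" using P.prob_compl[of "V k"] by linarith
    then have "emeasure (uniform_measure m (F n)) (V k) \<ge> ennreal (1/2)"
      unfolding P.emeasure_eq_measure by (rule ennreal_leI)
    then show ?thesis using n(1) Vop uniform_measure_folner_set(2)[OF m F]
      by (intro exI[of _ n]) (simp add: sets)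
  qed
  then obtain n where n: "\<And>k. n k \<ge> k"
    "\<And>k. emeasure m (F (n k) \<inter> V k) / emeasure m (F (n k)) \<ge> ennreal (1/2)" by metis
  define D where "D = (\<Union>k. F (n k) \<inter> V k)"
  have Fc: "compact (F k)" for k using F unfolding folner_sequence_def by blast
  have Fs: "F k \<in> sets borel" for k using uniform_measure_folner_set(2)[OF m F] sets by simp
  have D: "D \<in> sets borel" unfolding D_def using Fs Vop by auto
  have "ennreal (1/2) \<le> upper_density m F D"
    unfolding upper_density_def limsup_INF_SUP
  proof (rule INF_greatest)
    fix k
    have "ennreal (1/2) \<le> emeasure m (F (n k) \<inter> V k) / emeasure m (F (n k))" by (rule n)
    also have "\<dots> \<le> emeasure m (F (n k) \<inter> D) / emeasure m (F (n k))"
      using Fs D by (intro divide_right_mono_ennreal emeasure_mono) (auto simp: D_def sets)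
    also have "\<dots> \<le> (SUP j\<in>{k..}. emeasure m (F j \<inter> D) / emeasure m (F j))"
      using n(1) by (intro SUP_upper) auto
    finally show "ennreal (1/2) \<le> (SUP j\<in>{k..}. emeasure m (F j \<inter> D) / emeasure m (F j))" .
  qed
  moreover have "ennreal (1/2) > 0" by (subst ennreal_less_zero_iff) simp
  ultimately have "upper_density m F D > 0" by (rule less_le_trans[rotated])
  moreover have "(\<phi> \<longlongrightarrow> 0) (inf cocompact (principal D))"
  proof (rule tendstoI)
    fix e :: real assume "e > 0"
    then obtain k where k: "1 / real (Suc k) < e"
      using reals_Archimedean by (auto simp: inverse_eq_divide)
    have "dist (\<phi> g) 0 < e" if "g \<in> D" "g \<notin> (\<Union>j<k. F (n j))" for g
    proof -
      obtain j where j: "g \<in> F (n j)" "g \<in> V j" using \<open>g \<in> D\<close> by (auto simp: D_def)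
      have "j \<notin> {..<k}" using j(1) that(2) by blast
      then have "k \<le> j" by simp
      then have "1 / real (Suc j) \<le> 1 / real (Suc k)" by (simp add: frac_le)
      then show ?thesis using j(2) k nn[of g] by (simp add: V_def)
    qed
    moreover have "\<forall>\<^sub>F g in cocompact. g \<notin> (\<Union>j<k. F (n j))"
      unfolding cocompact_def
      by (rule eventually_INF1[of "\<Union>j<k. F (n j)"]) (auto simp: eventually_principal intro!: compact_UN Fc)
    ultimately show "\<forall>\<^sub>F g in inf cocompact (principal D). dist (\<phi> g) 0 < e"
      unfolding eventually_inf_principal by (auto elim: eventually_mono)
  qed
  ultimately show ?thesis using D by blast
qed

section \<open>Orbits of points generic for a trivial joining\<close>

text \<open>
  The function \<open>q \<mapsto> dist (z q\<^sub>i) q\<^sub>j\<close> is continuous and integrates to \<open>0\<close> against \<open>\<nu>\<close>. Centrality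
  of \<open>z\<close> makes its value at \<open>g p\<close> the distance between \<open>g (z p\<^sub>i)\<close> and \<open>g p\<^sub>j\<close>, a function of \<open>g\<close>
  whose averages therefore vanish.
\<close>

lemma graph_joining_weakly_asymptotic:
  fixes act :: "'g::{topological_group_add, t2_space} \<Rightarrow> 'x::metric_space \<Rightarrow> 'x"
  assumes X: "compact (UNIV :: 'x set)" and act: "continuous_action act"
    and m: "haar_measure m" and F: "folner_sequence m F"
    and gen: "generic_point act m F N p \<nu>"
    and sets: "sets \<nu> = sets (power_borel {..<N})"
    and ij: "i < N" "j < N" and z: "z \<in> group_center"
    and AE: "AE p in \<nu>. dist (act z (p i)) (p j) = 0"
    and ne: "act z (p i) \<noteq> p j"
  shows "weakly_asymptotic_pair act m F (act z (p i)) (p j)"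
proof -
  let ?f = "\<lambda>p. dist (act z (p i)) (p j)"
  have actm: "act g \<in> measurable borel borel" for g by (rule continuous_action_measurable[OF act])
  have fm: "?f \<in> borel_measurable (power_borel {..<N})"
    using ij unfolding power_borel_def
    by (intro borel_measurable_dist_compact[OF X] measurable_compose[OF _ actm]
          measurable_component_singleton) auto
  have ci: "continuous_map (power_topology N) euclidean (\<lambda>p. p k :: 'x)" if "k < N" for k
    unfolding power_topology_def using continuous_map_product_projection[of k "{..<N}" "\<lambda>_. euclidean"] that
    by simp
  have "continuous_map (power_topology N) euclidean (\<lambda>p. act z (p i))"
    using continuous_map_compose[OF ci[OF ij(1)], of euclidean "act z"] continuous_action_continuous(1)[OF act]
    by (simp add: o_def)
  then have "continuous_map (power_topology N) (prod_topology euclidean euclidean) (\<lambda>p. (act z (p i), p j))"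
    using ci[OF ij(2)] by (rule continuous_map_pairedI)
  then have "continuous_map (power_topology N) euclidean ((\<lambda>(a, b). dist a b) \<circ> (\<lambda>p. (act z (p i), p j)))"
    by (intro continuous_map_compose[of _ euclidean])
       (auto simp: euclidean_product_topology case_prod_beta intro!: continuous_intros)
  then have fc: "continuous_map (power_topology N) euclideanreal ?f" by (simp add: o_def)
  have "integral\<^sup>L \<nu> ?f = integral\<^sup>L \<nu> (\<lambda>_. 0)"
    using fm AE by (intro integral_cong_AE) (auto simp: sets cong: measurable_cong_sets)
  then have "(\<lambda>n. \<integral>g. ?f (power_act act N g p) \<partial>uniform_measure m (F n)) \<longlonglongrightarrow> 0"
    using generic_point_averages[OF act m gen fc fm] by simp
  moreover have "?f (power_act act N g p) = dist (act g (act z (p i))) (act g (p j))" for g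
  proof -
    have "act z (act g (p i)) = act (z + g) (p i)" using act by (simp add: continuous_action_def)
    also have "z + g = g + z" using z by (simp add: group_center_def)
    also have "act (g + z) (p i) = act g (act z (p i))" using act by (simp add: continuous_action_def)
    finally show ?thesis using ij by (simp add: power_act_def)
  qed
  ultimately have lim: "(\<lambda>n. \<integral>g. dist (act g (act z (p i))) (act g (p j)) \<partial>uniform_measure m (F n)) \<longlonglongrightarrow> 0"
    by simp
  obtain B where B: "\<And>x y :: 'x. dist x y \<le> B" using compact_dist_bounded[OF X] by blast
  have "continuous_on UNIV (\<lambda>g. dist (act g (act z (p i))) (act g (p j)))"
    by (intro continuous_intros continuous_action_continuous(2)[OF act])
  from upper_density_pos_if_averages_vanish[OF m F this _ B lim] ne
  show ?thesis unfolding weakly_asymptotic_pair_def by auto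
qed

text \<open>
  If the orbit missed a box around \<open>u\<close>, a continuous bump function supported in the box would vanish
  along the orbit, so its integral against \<open>\<nu>\<close> would be \<open>0\<close>; but it is positive on a smaller box,
  which has positive measure.
\<close>

lemma product_joining_dense_orbit:
  fixes act :: "'g::{topological_group_add, t2_space} \<Rightarrow> 'x::metric_space \<Rightarrow> 'x"
  assumes X: "compact (UNIV :: 'x set)" and act: "continuous_action act"
    and m: "haar_measure m"
    and gen: "generic_point act m F N p \<nu>"
    and sets: "sets \<nu> = sets (power_borel {..<N})" and prob: "prob_space \<nu>"
    and pos: "\<And>U. (\<And>i. i < N \<Longrightarrow> open (U i)) \<Longrightarrow> (\<And>i. i < N \<Longrightarrow> U i \<noteq> {}) \<Longrightarrow>
      emeasure \<nu> (Pi\<^sub>E {..<N} U) > 0"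
  shows "power_topology N closure_of orbit (power_act act N) p = topspace (power_topology N)"
proof (rule subset_antisym[OF closure_of_subset_topspace], rule subsetI)
  fix u :: "nat \<Rightarrow> 'x" assume u: "u \<in> topspace (power_topology N)"
  have "\<exists>y. y \<in> orbit (power_act act N) p \<and> y \<in> T" if T: "u \<in> T" "openin (power_topology N) T" for T
  proof -
    have "\<exists>U. (\<forall>i\<in>{..<N}. open (U i)) \<and> u \<in> Pi\<^sub>E {..<N} U \<and> Pi\<^sub>E {..<N} U \<subseteq> T"
      using T unfolding power_topology_def openin_product_topology_alt by auto
    then obtain U where U_open: "\<forall>i\<in>{..<N}. open (U i)"
      and U: "u \<in> Pi\<^sub>E {..<N} U" "Pi\<^sub>E {..<N} U \<subseteq> T"
      by (elim exE conjE)
    have "\<exists>r>0. ball (u i) r \<subseteq> U i" if "i < N" for i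
    proof -
      have "open (U i)" "u i \<in> U i" using U_open U(1) that by (auto simp: PiE_iff)
      then show ?thesis by (simp add: open_contains_ball)
    qed
    then obtain r where r: "\<And>i. i < N \<Longrightarrow> r i > 0" "\<And>i. i < N \<Longrightarrow> ball (u i) (r i) \<subseteq> U i" by metis
    define f where "f = (\<lambda>q. \<Prod>i<N. max 0 (r i - dist (q i) (u i)))"
    have f_pos: "f q > 0" if "q \<in> Pi\<^sub>E {..<N} (\<lambda>i. ball (u i) (r i))" for q
      using that unfolding f_def by (intro prod_pos) (auto simp: PiE_iff dist_commute)
    have f_supp: "q i \<in> U i" if "f q \<noteq> 0" "i < N" for q i
    proof -
      have "max 0 (r i - dist (q i) (u i)) \<noteq> 0" using that by (auto simp: f_def)
      then have "q i \<in> ball (u i) (r i)" by (auto simp: dist_commute max_def split: if_splits)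
      then show ?thesis using r(2)[OF \<open>i < N\<close>] by blast
    qed
    have f_nn: "f q \<ge> 0" for q unfolding f_def by (intro prod_nonneg) auto
    have f_bd: "f q \<le> (\<Prod>i<N. r i)" for q
      unfolding f_def using r(1) by (intro prod_mono) (auto simp: less_imp_le)
    have dm: "(\<lambda>y. dist y s) \<in> borel_measurable (borel :: 'x measure)" for s
      by (intro borel_measurable_continuous_onI continuous_intros)
    have fm: "f \<in> borel_measurable (power_borel {..<N})"
      unfolding f_def power_borel_def
      by (intro borel_measurable_prod borel_measurable_max borel_measurable_diff borel_measurable_const
          measurable_compose[OF _ dm] measurable_component_singleton)
    have cd: "continuous_map (power_topology N) euclideanreal (\<lambda>q. dist (q i) (u i))" if "i < N" for i
    proof -
      have "continuous_map (power_topology N) euclidean (\<lambda>p. p i :: 'x)"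
        unfolding power_topology_def
        using continuous_map_product_projection[of i "{..<N}" "\<lambda>_. euclidean"] that by simp
      then have "continuous_map (power_topology N) euclideanreal ((\<lambda>y. dist y (u i)) \<circ> (\<lambda>p. p i))"
        by (rule continuous_map_compose) (auto intro: continuous_intros)
      then show ?thesis by (simp add: o_def)
    qed
    have fc: "continuous_map (power_topology N) euclideanreal f"
      unfolding f_def by (intro continuous_map_prod continuous_map_real_max continuous_map_diff cd) auto
    interpret prob_space \<nu> by fact
    have fm\<nu>: "f \<in> borel_measurable \<nu>" using fm by (simp add: sets cong: measurable_cong_sets)
    have int: "integrable \<nu> f"
      using f_nn f_bd by (intro integrable_const_bound[of _ "\<Prod>i<N. r i"] fm\<nu>) auto
    have "\<exists>g. f (power_act act N g p) \<noteq> 0"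
    proof (rule ccontr)
      assume "\<nexists>g. f (power_act act N g p) \<noteq> 0"
      then have "integral\<^sup>L \<nu> f = 0"
        using generic_point_averages[OF act m gen fc fm] by (simp add: LIMSEQ_const_iff)
      then have "AE q in \<nu>. f q = 0" using integral_nonneg_eq_0_iff_AE[OF int] f_nn by simp
      then have "AE q in \<nu>. q \<notin> Pi\<^sub>E {..<N} (\<lambda>i. ball (u i) (r i))"
        by eventually_elim (use f_pos in force)
      then have "emeasure \<nu> {q \<in> space \<nu>. q \<in> Pi\<^sub>E {..<N} (\<lambda>i. ball (u i) (r i))} = 0"
        by (rule emeasure_eq_0_AE)
      moreover have "{q \<in> space \<nu>. q \<in> Pi\<^sub>E {..<N} (\<lambda>i. ball (u i) (r i))} = Pi\<^sub>E {..<N} (\<lambda>i. ball (u i) (r i))"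
        using sets_eq_imp_space_eq[OF sets] by (fastforce simp: power_borel_def space_PiM PiE_iff extensional_def)
      moreover have "emeasure \<nu> (Pi\<^sub>E {..<N} (\<lambda>i. ball (u i) (r i))) > 0"
        by (rule pos) (auto simp: not_le r(1))
      ultimately show False by simp
    qed
    then obtain g where "f (power_act act N g p) \<noteq> 0" ..
    then have "power_act act N g p i \<in> U i" if "i < N" for i using f_supp that by blast
    moreover have "power_act act N g p \<in> extensional {..<N}" by (simp add: power_act_def)
    ultimately have "power_act act N g p \<in> Pi\<^sub>E {..<N} U" by (simp add: PiE_iff)
    then show ?thesis using U(2) by (auto simp: orbit_def)
  qed
  then show "u \<in> power_topology N closure_of orbit (power_act act N) p"
    using u by (auto simp: in_closure_of)
qed

theorem proposition6p4:
  fixes act :: "'g::{topological_group_add, second_countable_topology, t2_space}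
                  \<Rightarrow> 'x::metric_space \<Rightarrow> 'x"
    and m :: "'g measure" and F :: "nat \<Rightarrow> 'g set" and \<mu> :: "'x measure"
  assumes "locally_compact_space (euclidean :: 'g topology)"
    and "amenable_group TYPE('g)"
    and "compact (UNIV :: 'x set)"
    and "continuous_action act"
    and "haar_measure m"
    and "folner_sequence m F" and "tempered m F"
    and "invariant_prob act borel \<mu>"
    and "minimal_action act"
    and "uniquely_ergodic act"
    and "mixing_all_orders act \<mu>"
    and "msj_all_orders act \<mu>"
    and "\<not> (\<exists>x y. weakly_asymptotic_pair act m F x y)"
    and "\<forall>N\<ge>1. \<forall>p\<in>{..<N} \<rightarrow>\<^sub>E UNIV.
           \<exists>\<nu>. ergodic_prob (power_act act N) (power_borel {..<N}) \<nu> \<and> generic_point act m F N p \<nu>"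
  shows "topological_msj_all_orders act"
  unfolding topological_msj_all_orders_def topological_msj_def
proof (intro allI impI ballI)
  fix N :: nat and p :: "nat \<Rightarrow> 'x"
  assume N: "2 \<le> N" and p: "p \<in> {..<N} \<rightarrow>\<^sub>E UNIV"
    and orb: "\<forall>i<N. \<forall>j<N. i \<noteq> j \<longrightarrow> p j \<notin> orbit act (p i)"
  note X = assms(3) and act = assms(4) and m = assms(5) and F = assms(6)
  have sets: "sets \<mu> = sets borel" and prob: "prob_space \<mu>" and inv: "distr \<mu> borel (act g) = \<mu>" for g
    using assms(8) by (auto simp: invariant_prob_def)
  have "N \<ge> 1" using N by simp
  then obtain \<nu> where erg: "ergodic_prob (power_act act N) (power_borel {..<N}) \<nu>"
    and gen: "generic_point act m F N p \<nu>"
    using assms(14) p by blast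
  then have \<nu>: "invariant_prob (power_act act N) (power_borel {..<N}) \<nu>"
    by (simp add: ergodic_prob_def)
  then have sets\<nu>: "sets \<nu> = sets (power_borel {..<N})" and prob\<nu>: "prob_space \<nu>"
    by (auto simp: invariant_prob_def)
  have "self_joining act \<mu> N \<nu>"
    by (rule invariant_measure_is_self_joining[OF act assms(10,8) \<nu>])
  then have triv: "trivial_joining act \<mu> N \<nu>"
    using assms(12) N erg unfolding msj_all_orders_def by blast
  show "power_topology N closure_of orbit (power_act act N) p = topspace (power_topology N)"
    using X act sets prob inv triv
  proof (cases rule: trivial_joining_cases)
    case (1 i j z)
    have "act z (p i) \<noteq> p j" using orb 1(1-3) unfolding orbit_def by (metis rangeI)
    from graph_joining_weakly_asymptotic[OF X act m F gen sets\<nu> 1(1,2,4,5) this]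
    show ?thesis using assms(13) by blast
  next
    case 2
    have "emeasure \<nu> (Pi\<^sub>E {..<N} U) > 0"
      if op: "\<And>i. i < N \<Longrightarrow> open (U i)" and ne: "\<And>i. i < N \<Longrightarrow> U i \<noteq> {}" for U
    proof -
      have "emeasure \<mu> (U i) > 0" if i: "i < N" for i
        by (rule minimal_full_support[OF X act assms(9,8) op[OF i] ne[OF i]])
      then have "(\<Prod>i<N. emeasure \<mu> (U i)) > 0" by (intro prod_ennreal_pos) auto
      moreover have "emeasure \<nu> (Pi\<^sub>E {..<N} U) = (\<Prod>i<N. emeasure \<mu> (U i))"
        by (rule 2) (rule borel_open[OF op])
      ultimately show ?thesis by simp
    qed
    then show ?thesis by (rule product_joining_dense_orbit[OF X act m gen sets\<nu> prob\<nu>])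
  qed
qed

end
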